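(* Let $\Omega\subset\mathbb{R}^d$ be open and bounded. Let $(\alpha_\varepsilon)_{\varepsilon\in(0,1)}$ be a family of radial functions $\alpha_\varepsilon:\mathbb{R}^d\setminus\{0\}\to[0,\infty)$ and $(\mu_\varepsilon(h)\,\mathrm{d}h)_{\varepsilon\in(0,1)}$ a family of symmetric measures with radial densities $\mu_\varepsilon\ge 0$ such that $$\int_{\mathbb{R}^d}\min\{1,|h|^2\}\,\alpha_\varepsilon(h)\mu_\varepsilon(h)\,\mathrm{d}h=d\quad\text{for all }\varepsilon\in(0,1),$$ $$\lim_{\varepsilon\to0^+}\int_{|h|>\delta}\alpha_\varepsilon(h)\mu_\varepsilon(h)\,\mathrm{d}h=0\quad\text{for all }\delta>0.$$ Let $F\in C^1(\overline\Omega;\mathbb{R}^d)$ be a vector field and let $(f_\varepsilon)_{\varepsilon\in(0,1)}$ be the family of nonlocal vector fields generated by $F$ with respect to $(\alpha_\varepsilon)$. Then $$\int_\Omega\mathcal{D}_\varepsilon f_\varepsilon(x)\,\mathrm{d}x\;\longrightarrow\;\int_\Omega\operatorname{div}F(x)\,\mathrm{d}x\qquad\text{as }\varepsilon\to0^+ .$$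
   Context: The vector field $F$ is assumed to be extended to a compactly supported $C^1$ vector field on $\mathbb{R}^d$, again denoted $F$. The nonlocal vector field generated by $F$ with respect to $\alpha_\varepsilon$ is the antisymmetric function $f_\varepsilon:\mathbb{R}^d\times\mathbb{R}^d\to\mathbb{R}$ given by $$f_\varepsilon(x,y)=\alpha_\varepsilon(x-y)\int_0^1F\big(x+t(y-x)\big)\cdot(y-x)\,\mathrm{d}t\quad(x\neq y),\qquad f_\varepsilon(x,x)=0 .$$ The nonlocal divergence operator is $$\mathcal{D}_\varepsilon f(x)=2\,\mathrm{pv.}\int_{\mathbb{R}^d}f(x,y)\,\mu_\varepsilon(y-x)\,\mathrm{d}y=2\lim_{\delta\to0^+}\int_{|y-x|>\delta}f(x,y)\,\mu_\varepsilon(y-x)\,\mathrm{d}y,\qquad x\in\Omega .$$ All functions are measurable. *)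

theory Defs
  imports "HOL-Analysis.Analysis"
begin

definition radial :: "(real ^ 'n \<Rightarrow> real) \<Rightarrow> bool" where
  "radial \<phi> \<longleftrightarrow> (\<forall>h h'. norm h = norm h' \<longrightarrow> \<phi> h = \<phi> h')"

definition C1_compactly_supported :: "(real ^ 'n \<Rightarrow> real ^ 'n) \<Rightarrow> bool" where
  "C1_compactly_supported F \<longleftrightarrow>
     (\<exists>F' :: real ^ 'n \<Rightarrow> (real ^ 'n) \<Rightarrow>\<^sub>L (real ^ 'n).
        (\<forall>x. (F has_derivative blinfun_apply (F' x)) (at x)) \<and> continuous_on UNIV F') \<and>
     compact (closure {x. F x \<noteq> 0})"

definition divergence :: "(real ^ 'n \<Rightarrow> real ^ 'n) \<Rightarrow> real ^ 'n \<Rightarrow> real" where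
  "divergence F x = (\<Sum>i\<in>UNIV. deriv (\<lambda>s. F (x + s *\<^sub>R axis i 1) $ i) 0)"

text \<open>The kernel \<open>\<alpha>\<close> lives on the punctured space; \<open>\<alpha> 0\<close> is a junk value which does not
  enter.\<close>

definition nonlocal_field ::
    "(real ^ 'n \<Rightarrow> real) \<Rightarrow> (real ^ 'n \<Rightarrow> real ^ 'n) \<Rightarrow> real ^ 'n \<Rightarrow> real ^ 'n \<Rightarrow> real" where
  "nonlocal_field \<alpha> F x y =
     (if x = y then 0
      else \<alpha> (x - y) * integral {0..1} (\<lambda>t. F (x + t *\<^sub>R (y - x)) \<bullet> (y - x)))"

definition truncated_div ::
    "(real ^ 'n \<Rightarrow> real) \<Rightarrow> (real ^ 'n \<Rightarrow> real ^ 'n \<Rightarrow> real) \<Rightarrow> real ^ 'n \<Rightarrow> real \<Rightarrow> real" where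
  "truncated_div \<mu> f x \<delta> = (LINT y:{y. \<delta> < norm (y - x)}|lebesgue. f x y * \<mu> (y - x))"

definition nonlocal_div ::
    "(real ^ 'n \<Rightarrow> real) \<Rightarrow> (real ^ 'n \<Rightarrow> real ^ 'n \<Rightarrow> real) \<Rightarrow> real ^ 'n \<Rightarrow> real" where
  "nonlocal_div \<mu> f x = 2 * Lim (at_right 0) (truncated_div \<mu> f x)"

text \<open>Since \<^const>\<open>Lim\<close> and the Lebesgue integral are total functions, the existence of the
  principal value defining \<^const>\<open>nonlocal_div\<close> is a separate property.\<close>

definition nonlocal_div_exists ::
    "(real ^ 'n \<Rightarrow> real) \<Rightarrow> (real ^ 'n \<Rightarrow> real ^ 'n \<Rightarrow> real) \<Rightarrow> real ^ 'n \<Rightarrow> bool" where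
  "nonlocal_div_exists \<mu> f x \<longleftrightarrow>
     (\<forall>\<delta>>0. set_integrable lebesgue {y. \<delta> < norm (y - x)} (\<lambda>y. f x y * \<mu> (y - x))) \<and>
     (\<exists>l. (truncated_div \<mu> f x \<longlongrightarrow> l) (at_right 0))"

end

theory Submission
  imports Defs
begin

text \<open>
  Write \<open>k = \<alpha> \<mu>\<close> for the kernel of the nonlocal divergence. Reflecting \<open>h \<mapsto> - h\<close> in the
  truncated integrals replaces the integrand by \<open>k h\<close> times the symmetrised line integral
  \<open>\<integral>\<^sub>0\<^sup>1 (F (x + t h) - F (x - t h)) \<bullet> h dt\<close>. This is \<open>O(min 1 (norm h)\<^sup>2)\<close> uniformly in \<open>x\<close>: for small
  \<open>h\<close> by the Lipschitz bound, for large \<open>h\<close> by compact support. Hence the principal value exists,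
  is an absolutely convergent integral, and is bounded uniformly in \<open>\<epsilon>\<close> and \<open>x\<close>. Up to \<open>o((norm h)\<^sup>2)\<close> the
  symmetrised integral equals \<open>(F' x) h \<bullet> h\<close>. A radial measure has second moments proportional to the
  identity matrix, so integrating this quadratic form gives the trace of \<open>F' x\<close>, while the mass
  concentrates at the origin as \<open>\<epsilon>\<close> tends to 0. The convergence is therefore pointwise, and
  dominated convergence on the bounded set \<open>\<Omega>\<close> concludes.
\<close>

section \<open>Invariance of Lebesgue measure and radial moments\<close>

lemma borel_measurable_lebesgue_continuous:
  fixes f :: "'a::euclidean_space \<Rightarrow> real"
  assumes "continuous_on UNIV f"
  shows "f \<in> borel_measurable lebesgue"
  using assms by (intro measurable_completion) (simp add: borel_measurable_continuous_onI)

lemma borel_measurable_lebesgue_norm [measurable]: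
  "(norm :: 'a::euclidean_space \<Rightarrow> real) \<in> borel_measurable lebesgue"
  by (intro borel_measurable_lebesgue_continuous continuous_intros)

lemma sets_lebesgue_norm_greater [measurable]:
  "{x :: 'a::euclidean_space. c < norm x} \<in> sets lebesgue"
  by (intro sets_completionI_sets) (auto intro!: borel_open open_Collect_less continuous_intros)

text \<open>Invariance of \<open>lborel\<close> passes to its completion: completing commutes with
  pushing forward, and a map with this invariance pulls null sets back to null sets.\<close>

lemma
  assumes T [measurable]: "T \<in> borel \<rightarrow>\<^sub>M borel" and eq: "distr lborel borel T = lborel"
  shows lebesgue_measurable_if_lborel_invariant: "T \<in> lebesgue \<rightarrow>\<^sub>M lebesgue"
    and distr_lebesgue_if_lborel_invariant: "distr lebesgue lebesgue T = lebesgue"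
proof -
  have leb: "distr lebesgue lborel T = lborel"
    using eq by (simp add: distr_completion cong: distr_cong)
  show "T \<in> lebesgue \<rightarrow>\<^sub>M lebesgue"
    by (intro completion.measurable_completion2) (auto simp: leb measurable_completion)
  show "distr lebesgue lebesgue T = lebesgue"
    by (subst completion.completion_distr_eq[symmetric]) (auto simp: leb measurable_completion)
qed

lemma emeasure_lborel_box_cart:
  fixes l u :: "real ^ 'n"
  assumes "\<And>i. l $ i \<le> u $ i"
  shows "emeasure lborel (box l u) = ennreal (\<Prod>i\<in>UNIV. u $ i - l $ i)"
proof -
  have Basis: "(Basis :: (real ^ 'n) set) = (\<lambda>i. axis i 1) ` UNIV"
    by (auto simp: Basis_vec_def)
  have "inj (\<lambda>i. axis i 1 :: real ^ 'n)"
    by (auto simp: inj_on_def axis_eq_axis)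
  then have "(\<Prod>b\<in>Basis. (u - l) \<bullet> b) = (\<Prod>i\<in>UNIV. u $ i - l $ i)"
    unfolding Basis by (subst prod.reindex) (auto simp: inner_axis)
  moreover have "l \<bullet> b \<le> u \<bullet> b" if "b \<in> Basis" for b
    using that assms unfolding Basis by (auto simp: inner_axis)
  ultimately show ?thesis
    by (simp add: emeasure_lborel_box)
qed

text \<open>Lebesgue measure is determined by its values on boxes, and the preimage of a box under a
  signed permutation is a box with the same side lengths in another order.\<close>

lemma distr_lborel_signed_permutation:
  fixes p :: "'n::finite \<Rightarrow> 'n"
  assumes p: "bij p" and s: "\<And>i. \<bar>s i\<bar> = 1"
  defines "T \<equiv> \<lambda>x :: real ^ 'n. \<chi> i. s i * x $ p i"
  shows "T \<in> borel \<rightarrow>\<^sub>M borel" and "distr lborel borel T = lborel"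
proof -
  have "linear T"
    by (rule linearI) (auto simp: T_def vec_eq_iff algebra_simps)
  then show T [measurable]: "T \<in> borel \<rightarrow>\<^sub>M borel"
    by (intro borel_measurable_continuous_onI linear_continuous_on linear_conv_bounded_linear[THEN iffD1])
  show "distr lborel borel T = lborel"
  proof (rule lborel_eqI[symmetric])
    fix l u :: "real ^ 'n"
    assume "\<And>b. b \<in> Basis \<Longrightarrow> l \<bullet> b \<le> u \<bullet> b"
    then have le: "l $ i \<le> u $ i" for i
      by (metis axis_in_Basis_iff cart_eq_inner_axis real_inner_1_right Basis_real_def insertI1)
    define q where "q = inv p"
    have pq: "p (q i) = i" "q (p i) = i" for i
      using p by (auto simp: q_def bij_is_surj surj_f_inv_f bij_is_inj)
    have all_q: "(\<forall>i. P i) \<longleftrightarrow> (\<forall>j. P (q j))" for P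
      by (metis pq(2))
    \<comment> \<open>A negative sign reflects the interval of its coordinate, so the endpoints are
      exchanged and negated.\<close>
    define l' :: "real ^ 'n" where "l' = (\<chi> j. if s (q j) = 1 then l $ q j else - u $ q j)"
    define u' :: "real ^ 'n" where "u' = (\<chi> j. if s (q j) = 1 then u $ q j else - l $ q j)"
    have s': "s i = 1 \<or> s i = -1" for i
      using s[of i] by linarith
    have "T x \<in> box l u \<longleftrightarrow> x \<in> box l' u'" for x
    proof -
      have "T x \<in> box l u \<longleftrightarrow> (\<forall>j. l $ q j < s (q j) * x $ p (q j) \<and> s (q j) * x $ p (q j) < u $ q j)"
        using all_q[of "\<lambda>i. l $ i < s i * x $ p i \<and> s i * x $ p i < u $ i"]
        by (simp add: mem_box_cart T_def)
      also have "\<dots> \<longleftrightarrow> (\<forall>j. l' $ j < x $ j \<and> x $ j < u' $ j)"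
      proof (intro all_cong1)
        show "(l $ q j < s (q j) * x $ p (q j) \<and> s (q j) * x $ p (q j) < u $ q j) \<longleftrightarrow>
            (l' $ j < x $ j \<and> x $ j < u' $ j)" for j
          using s'[of "q j"] by (auto simp: l'_def u'_def pq)
      qed
      finally show ?thesis
        by (simp add: mem_box_cart)
    qed
    then have "emeasure (distr lborel borel T) (box l u) = emeasure lborel (box l' u')"
      by (subst emeasure_distr) (auto simp: vimage_def)
    also have "\<dots> = ennreal (\<Prod>j\<in>UNIV. u' $ j - l' $ j)"
      using le by (intro emeasure_lborel_box_cart) (auto simp: l'_def u'_def)
    also have "(\<Prod>j\<in>UNIV. u' $ j - l' $ j) = (\<Prod>j\<in>UNIV. u $ q j - l $ q j)"
      by (intro prod.cong) (auto simp: l'_def u'_def)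
    also have "\<dots> = (\<Prod>i\<in>UNIV. u $ i - l $ i)"
      using bij_imp_bij_inv[OF p] by (intro prod.reindex_bij_betw) (simp add: q_def)
    also have "ennreal \<dots> = emeasure lborel (box l u)"
      using le by (simp add: emeasure_lborel_box_cart)
    also have "\<dots> = (\<Prod>b\<in>Basis. (u - l) \<bullet> b)"
      using \<open>\<And>b. b \<in> Basis \<Longrightarrow> l \<bullet> b \<le> u \<bullet> b\<close> by simp
    finally show "emeasure (distr lborel borel T) (box l u) = (\<Prod>b\<in>Basis. (u - l) \<bullet> b)" .
  qed simp
qed

lemma lebesgue_integral_signed_permutation:
  fixes p :: "'n::finite \<Rightarrow> 'n" and f :: "real ^ 'n \<Rightarrow> real"
  assumes p: "bij p" and s: "\<And>i. \<bar>s i\<bar> = 1" and f: "f \<in> borel_measurable lebesgue"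
  shows "(LINT x|lebesgue. f (\<chi> i. s i * x $ p i)) = (LINT x|lebesgue. f x)"
proof -
  note T = distr_lborel_signed_permutation[where s = s, OF p s]
  show ?thesis
    by (subst (2) distr_lebesgue_if_lborel_invariant[OF T, symmetric])
      (rule integral_distr[symmetric, OF lebesgue_measurable_if_lborel_invariant[OF T] f])
qed

text \<open>Used to pass from the variable \<open>y\<close> to the increment
  \<open>h = y - x\<close> in the truncated integrals.\<close>

lemma
  fixes f :: "'a::euclidean_space \<Rightarrow> real"
  assumes f: "f \<in> borel_measurable lebesgue"
  shows integrable_lebesgue_translation: "integrable lebesgue (\<lambda>x. f (x - a)) \<longleftrightarrow> integrable lebesgue f"
    and lebesgue_integral_translation: "(LINT x|lebesgue. f (x - a)) = (LINT x|lebesgue. f x)"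
proof -
  have T: "(\<lambda>x. x - a) \<in> borel \<rightarrow>\<^sub>M borel" "distr lborel borel (\<lambda>x. x - a) = (lborel :: 'a measure)"
    using lborel_distr_plus[of "- a"] by (simp_all add: add.commute[of "- a"] cong: distr_cong)
  note dist = distr_lebesgue_if_lborel_invariant[OF T] lebesgue_measurable_if_lborel_invariant[OF T]
  show "integrable lebesgue (\<lambda>x. f (x - a)) \<longleftrightarrow> integrable lebesgue f"
    by (subst (2) dist(1)[symmetric]) (rule integrable_distr_eq[symmetric, OF dist(2) f])
  show "(LINT x|lebesgue. f (x - a)) = (LINT x|lebesgue. f x)"
    by (subst (2) dist(1)[symmetric]) (rule integral_distr[symmetric, OF dist(2) f])
qed

lemma lebesgue_integral_reflect:
  fixes f :: "real ^ 'n \<Rightarrow> real"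
  assumes "f \<in> borel_measurable lebesgue"
  shows "(LINT x|lebesgue. f (- x)) = (LINT x|lebesgue. f x)"
proof -
  have "(\<chi> i. - 1 * x $ id i) = - x" for x :: "real ^ 'n"
    by (simp add: vec_eq_iff)
  then show ?thesis
    using lebesgue_integral_signed_permutation[of id "\<lambda>_. -1" f] assms by simp
qed

lemma norm_signed_permutation:
  fixes x :: "real ^ 'n"
  assumes p: "bij p" and s: "\<And>i. \<bar>s i\<bar> = 1"
  shows "norm (\<chi> i. s i * x $ p i :: real ^ 'n) = norm x"
proof -
  have "(s i * x $ p i)\<^sup>2 = (x $ p i)\<^sup>2" for i
    using s by (metis abs_mult mult_1 power2_abs)
  then show ?thesis
    using sum.reindex_bij_betw[OF p, of "\<lambda>i. (x $ i)\<^sup>2"] by (simp add: norm_vec_def L2_set_def)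
qed

section \<open>Second moments of radial weights\<close>

text \<open>Signed coordinate permutations are enough symmetry: negating one coordinate reverses the
  sign of a mixed moment, and transposing two coordinates equates diagonal moments, which add up to
  the integral of \<open>\<phi> h * (norm h)\<^sup>2\<close>.\<close>

lemma radial_second_moment:
  fixes \<phi> :: "real ^ 'n \<Rightarrow> real"
  assumes \<phi>: "\<phi> \<in> borel_measurable lebesgue" "radial \<phi>"
    and int: "integrable lebesgue (\<lambda>h. \<phi> h * (norm h)\<^sup>2)"
  shows "integrable lebesgue (\<lambda>h. \<phi> h * (h $ i * h $ j))"
    and "(LINT h|lebesgue. \<phi> h * (h $ i * h $ j)) =
      (if i = j then (LINT h|lebesgue. \<phi> h * (norm h)\<^sup>2) / real CARD('n) else 0)"
proof -
  have [measurable]: "(\<lambda>h :: real ^ 'n. h $ k) \<in> borel_measurable lebesgue" for k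
    by (intro borel_measurable_lebesgue_continuous continuous_intros)
  note [measurable] = \<phi>(1)
  have rad: "\<phi> (\<chi> i. s i * h $ p i) = \<phi> h" if "bij p" "\<And>i. \<bar>s i\<bar> = 1" for s p h
    by (rule \<phi>(2)[unfolded radial_def, rule_format, OF norm_signed_permutation[OF that]])
  show I: "integrable lebesgue (\<lambda>h. \<phi> h * (h $ i * h $ j))" for i j
  proof (rule Bochner_Integration.integrable_bound[OF int])
    show "(\<lambda>h. \<phi> h * (h $ i * h $ j)) \<in> borel_measurable lebesgue"
      by measurable
    show "AE h in lebesgue. norm (\<phi> h * (h $ i * h $ j)) \<le> norm (\<phi> h * (norm h)\<^sup>2)"
      by (intro AE_I2) (auto simp: abs_mult power2_eq_square intro!: mult_mono component_le_norm_cart)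
  qed
  have diag: "(LINT h|lebesgue. \<phi> h * (h $ i * h $ i)) = (LINT h|lebesgue. \<phi> h * (h $ k * h $ k))" for k
    using lebesgue_integral_signed_permutation[of "Transposition.transpose i k" "\<lambda>_. 1" "\<lambda>h. \<phi> h * (h $ i * h $ i)"]
      rad[of "Transposition.transpose i k" "\<lambda>_. 1"] by simp
  show "(LINT h|lebesgue. \<phi> h * (h $ i * h $ j)) =
      (if i = j then (LINT h|lebesgue. \<phi> h * (norm h)\<^sup>2) / real CARD('n) else 0)"
  proof (cases "i = j")
    case True
    have "(norm h)\<^sup>2 = (\<Sum>k\<in>UNIV. h $ k * h $ k)" for h :: "real ^ 'n"
      by (simp add: power2_norm_eq_inner inner_vec_def)
    then have "(LINT h|lebesgue. \<phi> h * (norm h)\<^sup>2) = (LINT h|lebesgue. (\<Sum>k\<in>UNIV. \<phi> h * (h $ k * h $ k)))"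
      by (simp add: sum_distrib_left)
    also have "\<dots> = (\<Sum>k\<in>UNIV. LINT h|lebesgue. \<phi> h * (h $ k * h $ k))"
      by (intro Bochner_Integration.integral_sum I)
    also have "\<dots> = (\<Sum>k\<in>(UNIV :: 'n set). LINT h|lebesgue. \<phi> h * (h $ i * h $ i))"
      by (intro sum.cong refl diag[symmetric])
    finally show ?thesis
      using True by simp
  next
    case False
    define s where "s k = (if k = i then -1 else 1 :: real)" for k
    have "(LINT h|lebesgue. \<phi> h * (h $ i * h $ j)) = (LINT h|lebesgue. - (\<phi> h * (h $ i * h $ j)))"
      using lebesgue_integral_signed_permutation[of id s "\<lambda>h. \<phi> h * (h $ i * h $ j)"]
        rad[of id s] False by (simp add: s_def)
    then show ?thesis
      using False by simp
  qed
qed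

text \<open>Expanding \<open>A h \<bullet> h\<close> in the matrix entries of \<open>A\<close>
  reduces everything to the second moments; the mixed ones vanish and the trace remains.\<close>

lemma radial_quadratic_moment:
  fixes \<phi> :: "real ^ 'n \<Rightarrow> real" and A :: "real ^ 'n \<Rightarrow> real ^ 'n"
  assumes \<phi>: "\<phi> \<in> borel_measurable lebesgue" "radial \<phi>"
    and int: "integrable lebesgue (\<lambda>h. \<phi> h * (norm h)\<^sup>2)" and A: "linear A"
  shows "integrable lebesgue (\<lambda>h. \<phi> h * (A h \<bullet> h))"
    and "(LINT h|lebesgue. \<phi> h * (A h \<bullet> h)) =
      (\<Sum>i\<in>UNIV. A (axis i 1) $ i) * (LINT h|lebesgue. \<phi> h * (norm h)\<^sup>2) / real CARD('n)"
proof -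
  define M where "M i j = A (axis j 1) $ i" for i j
  have "A h $ i = (\<Sum>j\<in>UNIV. M i j * h $ j)" for h i
    using arg_cong[OF fun_cong[OF matrix_vector_mul(2)[OF A], of h], of "\<lambda>v. v $ i"]
    by (simp add: M_def matrix_def matrix_vector_mult_def)
  then have eq: "\<phi> h * (A h \<bullet> h) = (\<Sum>i\<in>UNIV. \<Sum>j\<in>UNIV. M i j * (\<phi> h * (h $ j * h $ i)))" for h
    by (simp add: inner_vec_def sum_distrib_left sum_distrib_right mult_ac)
  note mom = radial_second_moment[OF \<phi> int]
  show "integrable lebesgue (\<lambda>h. \<phi> h * (A h \<bullet> h))"
    unfolding eq by (intro Bochner_Integration.integrable_sum integrable_mult_right mom)
  have "(LINT h|lebesgue. \<phi> h * (A h \<bullet> h)) =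
      (\<Sum>i\<in>UNIV. \<Sum>j\<in>UNIV. M i j * (LINT h|lebesgue. \<phi> h * (h $ j * h $ i)))"
    unfolding eq by (simp add: Bochner_Integration.integral_sum mom(1))
  also have "\<dots> = (\<Sum>i\<in>UNIV. M i i * ((LINT h|lebesgue. \<phi> h * (norm h)\<^sup>2) / real CARD('n)))"
    by (simp add: mom if_distrib[of "\<lambda>z. _ * z"] sum.delta' cong: if_cong)
  finally show "(LINT h|lebesgue. \<phi> h * (A h \<bullet> h)) =
      (\<Sum>i\<in>UNIV. A (axis i 1) $ i) * (LINT h|lebesgue. \<phi> h * (norm h)\<^sup>2) / real CARD('n)"
    by (simp add: M_def sum_distrib_right sum_divide_distrib)
qed

section \<open>Line integrals of a vector field\<close>

text \<open>This is \<open>nonlocal_field\<close> without its kernel factor, written in the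
  increment \<open>h = y - x\<close>.\<close>

definition line_flux :: "('a::euclidean_space \<Rightarrow> 'a) \<Rightarrow> 'a \<Rightarrow> 'a \<Rightarrow> real" where
  "line_flux F x h = integral {0..1} (\<lambda>t. F (x + t *\<^sub>R h) \<bullet> h)"

text \<open>A sum encodes a difference here: the inner product with \<open>- h\<close> already
  reverses the sign, so the contributions of \<open>F x\<close> cancel.\<close>

definition sym_flux :: "('a::euclidean_space \<Rightarrow> 'a) \<Rightarrow> 'a \<Rightarrow> 'a \<Rightarrow> real" where
  "sym_flux F x h = line_flux F x h + line_flux F x (- h)"

text \<open>Joint continuity serves twice: for measurability in the increment, and for continuity in
  the base point, on which the measurability of \<open>kernel_div\<close> rests.\<close>

lemma continuous_on_line_flux:
  fixes F :: "'a::euclidean_space \<Rightarrow> 'a"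
  assumes F: "continuous_on UNIV F"
  shows "continuous_on UNIV (\<lambda>p. line_flux F (fst p) (snd p))"
proof -
  have "continuous_on (UNIV \<times> cbox 0 1)
      (\<lambda>(p, t :: real). F (fst p + t *\<^sub>R snd p) \<bullet> snd p)"
    unfolding split_beta
    by (intro continuous_intros continuous_on_compose2[OF F]) auto
  from integral_continuous_on_param[OF this] show ?thesis
    by (simp add: line_flux_def)
qed

lemma continuous_on_sym_flux:
  fixes F :: "'a::euclidean_space \<Rightarrow> 'a"
  assumes "continuous_on UNIV F"
  shows "continuous_on UNIV (\<lambda>p. sym_flux F (fst p) (snd p))"
proof -
  have "continuous_on UNIV (\<lambda>p :: 'a \<times> 'a. line_flux F (fst (fst p, - snd p)) (snd (fst p, - snd p)))"
    by (intro continuous_on_compose2[OF continuous_on_line_flux[OF assms]] continuous_intros) auto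
  then show ?thesis
    unfolding sym_flux_def using continuous_on_line_flux[OF assms] by (intro continuous_on_add) simp_all
qed

lemma sym_flux_eq_integral:
  fixes F :: "'a::euclidean_space \<Rightarrow> 'a"
  assumes F: "continuous_on UNIV F"
  shows "sym_flux F x h = integral {0..1} (\<lambda>t. (F (x + t *\<^sub>R h) - F (x - t *\<^sub>R h)) \<bullet> h)"
proof -
  have "continuous_on {0..1} (\<lambda>t. F (x + t *\<^sub>R h) \<bullet> h)" for h
    by (intro continuous_intros continuous_on_compose2[OF F]) auto
  note int = integrable_continuous_real[OF this]
  show ?thesis
    unfolding sym_flux_def line_flux_def Henstock_Kurzweil_Integration.integral_add[OF int int, symmetric]
    by (simp add: inner_diff_left)
qed

text \<open>The segment from \<open>x\<close> to \<open>x + h\<close> meets the support of \<open>F\<close> in a parameter set of length at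
  most a constant times \<open>1 / norm h\<close>.\<close>

lemma line_flux_bounded:
  fixes F :: "'a::euclidean_space \<Rightarrow> 'a"
  assumes F: "continuous_on UNIV F" and supp: "bounded {x. F x \<noteq> 0}"
  obtains C where "0 \<le> C" "\<And>x h. \<bar>line_flux F x h\<bar> \<le> C"
proof -
  obtain R where R: "0 < R" "\<And>x. F x \<noteq> 0 \<Longrightarrow> norm x \<le> R"
    using supp by (auto simp: bounded_pos)
  have "bounded (F ` cball 0 R)"
    by (intro compact_imp_bounded compact_continuous_image continuous_on_subset[OF F]) auto
  then obtain M where M: "0 < M" "\<And>x. x \<in> cball 0 R \<Longrightarrow> norm (F x) \<le> M"
    by (auto simp: bounded_pos)
  have "\<bar>line_flux F x h\<bar> \<le> 4 * R * M" for x h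
  \<comment> \<open>If the whole line misses the support, the integral vanishes. Otherwise any
    parameter \<open>s\<close> that hits the support, possibly outside the unit interval, can serve
    as a centre.\<close>
  proof (cases "h \<noteq> 0 \<and> (\<exists>t. F (x + t *\<^sub>R h) \<noteq> 0)")
    case False
    then have "F (x + t *\<^sub>R h) \<bullet> h = 0" for t
      by auto
    then show ?thesis
      using R M by (simp add: line_flux_def)
  next
    case True
    then obtain s where s: "F (x + s *\<^sub>R h) \<noteq> 0" and h: "norm h > 0"
      by auto
    \<comment> \<open>Two points of the support are at most \<open>2 * R\<close> apart, so their
      parameters on the line differ by at most \<open>r\<close>.\<close>
    define r where "r = 2 * R / norm h"
    have r: "r \<ge> 0" "r * norm h = 2 * R"
      using R h by (auto simp: r_def)
    define g where "g t = (if t \<in> {s - r..s + r} then M * norm h else 0)" for t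
    have Int: "{0..1} \<inter> {s - r..s + r} = {max 0 (s - r)..min 1 (s + r)}"
      "{s - r..s + r} \<inter> {0..1} = {max 0 (s - r)..min 1 (s + r)}"
      by auto
    have g: "g integrable_on {0..1}"
      unfolding g_def integrable_restrict_Int Int by (rule integrable_const_ivl)
    have "norm (F (x + t *\<^sub>R h) \<bullet> h) \<le> g t" for t
    proof (cases "F (x + t *\<^sub>R h) = 0")
      case True
      then show ?thesis
        using M by (simp add: g_def)
    next
      case False
      have "\<bar>t - s\<bar> * norm h = norm ((x + t *\<^sub>R h) - (x + s *\<^sub>R h))"
        by (simp flip: scaleR_diff_left)
      also have "\<dots> \<le> r * norm h"
        using norm_triangle_ineq4[of "x + t *\<^sub>R h" "x + s *\<^sub>R h"] R(2)[OF False] R(2)[OF s] r by linarith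
      finally have "\<bar>t - s\<bar> \<le> r"
        using h by simp
      then have "t \<in> {s - r..s + r}"
        by auto
      moreover have "norm (F (x + t *\<^sub>R h) \<bullet> h) \<le> M * norm h"
        using M(2)[of "x + t *\<^sub>R h"] R(2)[OF False]
        by (intro order_trans[OF Cauchy_Schwarz_ineq2[folded real_norm_def]] mult_right_mono) auto
      ultimately show ?thesis
        by (simp add: g_def)
    qed
    moreover have "(\<lambda>t. F (x + t *\<^sub>R h) \<bullet> h) integrable_on {0..1}"
      by (intro integrable_continuous_real continuous_intros continuous_on_compose2[OF F]) auto
    ultimately have "norm (line_flux F x h) \<le> integral {0..1} g"
      unfolding line_flux_def by (intro integral_norm_bound_integral g) auto
    also have "\<dots> = M * norm h * measure lborel {max 0 (s - r)..min 1 (s + r)}"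
      unfolding g_def integral_restrict_Int Int by simp
    \<comment> \<open>The factor \<open>norm h\<close> in the integrand is compensated by
      \<open>r\<close>, which leaves a constant independent of \<open>h\<close>.\<close>
    also have "\<dots> \<le> M * norm h * (2 * r)"
      using M r h by (intro mult_left_mono) (auto simp: content_real_if)
    also have "\<dots> = 2 * M * (r * norm h)"
      by simp
    finally show ?thesis
      by (simp add: r mult_ac)
  qed
  then show thesis
    using R M by (intro that[of "4 * R * M"]) auto
qed

section \<open>Regularity of compactly supported fields\<close>

lemma C1_compactly_supported_imp_continuous:
  assumes "C1_compactly_supported F"
  shows "continuous_on UNIV F"
proof -
  obtain F' where "\<And>x. (F has_derivative blinfun_apply (F' x)) (at x)"
    using assms unfolding C1_compactly_supported_def by blast
  then show ?thesis
    by (intro continuous_at_imp_continuous_on ballI has_derivative_continuous)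
qed

lemma C1_compactly_supported_imp_bounded_support:
  assumes "C1_compactly_supported F"
  shows "bounded {x. F x \<noteq> 0}"
  using assms unfolding C1_compactly_supported_def
  by (meson bounded_subset closure_subset compact_imp_bounded)

text \<open>The derivative is bounded on the support by compactness and vanishes on the open
  complement, so the mean value inequality applies on the whole space.\<close>

lemma C1_compactly_supported_imp_Lipschitz:
  fixes F :: "real ^ 'n \<Rightarrow> real ^ 'n"
  assumes "C1_compactly_supported F"
  obtains L where "0 \<le> L" "\<And>x y. norm (F x - F y) \<le> L * norm (x - y)"
proof -
  obtain F' :: "real ^ 'n \<Rightarrow> (real ^ 'n) \<Rightarrow>\<^sub>L (real ^ 'n)"
    where F': "\<And>x. (F has_derivative blinfun_apply (F' x)) (at x)" "continuous_on UNIV F'"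
    and K: "compact (closure {x. F x \<noteq> 0})"
    using assms unfolding C1_compactly_supported_def by blast
  have "bounded (F' ` closure {x. F x \<noteq> 0})"
    by (intro compact_imp_bounded compact_continuous_image continuous_on_subset[OF F'(2)] K) auto
  then obtain L where L: "0 < L" "\<And>x. x \<in> closure {x. F x \<noteq> 0} \<Longrightarrow> norm (F' x) \<le> L"
    by (auto simp: bounded_pos)
  have "norm (F' x) \<le> L" for x
  proof (cases "x \<in> closure {x. F x \<noteq> 0}")
    case False
    have "(F has_derivative (\<lambda>_. 0)) (at x)"
    proof (rule has_derivative_transform_within_open[where s = "- closure {x. F x \<noteq> 0}"])
      show "((\<lambda>_. 0) has_derivative (\<lambda>_. 0)) (at x)"
        by simp
      show "0 = F y" if "y \<in> - closure {x. F x \<noteq> 0}" for y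
        using that closure_subset[of "{x. F x \<noteq> 0}"] by auto
    qed (use False in auto)
    then have "blinfun_apply (F' x) = (\<lambda>_. 0)"
      using F'(1) has_derivative_unique by blast
    then have "F' x = 0"
      by (auto intro: blinfun_eqI)
    then show ?thesis
      using L by simp
  qed (use L in auto)
  then have "norm (F y - F x) \<le> L * norm (y - x)" for x y
    by (intro differentiable_bound[of UNIV F "\<lambda>x. blinfun_apply (F' x)"])
      (auto simp: F' norm_blinfun.rep_eq[symmetric])
  then show thesis
    using L by (intro that[of L]) auto
qed

section \<open>Size and expansion of the symmetrised flux\<close>

lemma sym_flux_quadratic_bound:
  fixes F :: "'a::euclidean_space \<Rightarrow> 'a"
  assumes F: "continuous_on UNIV F" and L: "0 \<le> L" "\<And>x y. norm (F x - F y) \<le> L * norm (x - y)"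
  shows "\<bar>sym_flux F x h\<bar> \<le> 2 * L * (norm h)\<^sup>2"
proof -
  have "norm (integral {0..1} (\<lambda>t. (F (x + t *\<^sub>R h) - F (x - t *\<^sub>R h)) \<bullet> h)) \<le> 2 * L * (norm h)\<^sup>2 * (1 - 0)"
  proof (intro integral_bound)
    show "continuous_on {0..1} (\<lambda>t. (F (x + t *\<^sub>R h) - F (x - t *\<^sub>R h)) \<bullet> h)"
      by (intro continuous_intros continuous_on_compose2[OF F]) auto
    show "norm ((F (x + t *\<^sub>R h) - F (x - t *\<^sub>R h)) \<bullet> h) \<le> 2 * L * (norm h)\<^sup>2" if "t \<in> {0..1}" for t
    proof -
      have "(x + t *\<^sub>R h) - (x - t *\<^sub>R h) = (2 * t) *\<^sub>R h"
        by (simp add: algebra_simps flip: scaleR_2)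
      then have "norm (F (x + t *\<^sub>R h) - F (x - t *\<^sub>R h)) \<le> L * (2 * t * norm h)"
        using L(2)[of "x + t *\<^sub>R h" "x - t *\<^sub>R h"] that by simp
      also have "\<dots> \<le> L * (2 * 1 * norm h)"
        using that L by (intro mult_left_mono mult_right_mono) auto
      finally have "norm (F (x + t *\<^sub>R h) - F (x - t *\<^sub>R h)) * norm h \<le> 2 * L * norm h * norm h"
        by (intro mult_right_mono) auto
      then show ?thesis
        using Cauchy_Schwarz_ineq2[of "F (x + t *\<^sub>R h) - F (x - t *\<^sub>R h)" h]
        by (simp add: power2_eq_square mult_ac)
    qed
  qed simp
  then show ?thesis
    by (simp add: sym_flux_eq_integral[OF F])
qed

text \<open>The Lipschitz estimate covers small increments and the uniform bound on
  \<open>line_flux\<close> large ones. Together they give the very weight that normalises the mass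
  of the kernels.\<close>

lemma sym_flux_bound:
  fixes F :: "real ^ 'n \<Rightarrow> real ^ 'n"
  assumes F: "C1_compactly_supported F"
  obtains C where "0 \<le> C" "\<And>x h. \<bar>sym_flux F x h\<bar> \<le> C * min 1 ((norm h)\<^sup>2)"
proof -
  note cont = C1_compactly_supported_imp_continuous[OF F]
  obtain C where C: "0 \<le> C" "\<And>x h. \<bar>line_flux F x h\<bar> \<le> C"
    using line_flux_bounded[OF cont C1_compactly_supported_imp_bounded_support[OF F]] by blast
  obtain L where L: "0 \<le> L" "\<And>x y. norm (F x - F y) \<le> L * norm (x - y)"
    using C1_compactly_supported_imp_Lipschitz[OF F] by blast
  have "\<bar>sym_flux F x h\<bar> \<le> max (2 * C) (2 * L) * min 1 ((norm h)\<^sup>2)" for x h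
  proof (cases "(norm h)\<^sup>2 \<le> 1")
    case True
    have "\<bar>sym_flux F x h\<bar> \<le> 2 * L * (norm h)\<^sup>2"
      by (rule sym_flux_quadratic_bound[OF cont L])
    also have "\<dots> \<le> max (2 * C) (2 * L) * (norm h)\<^sup>2"
      by (intro mult_right_mono) auto
    finally show ?thesis
      using True by (simp add: min_def)
  next
    case False
    then show ?thesis
      using C(2)[of x h] C(2)[of x "- h"] by (simp add: sym_flux_def min_def)
  qed
  then show thesis
    using C by (intro that[of "max (2 * C) (2 * L)"]) auto
qed

text \<open>In the difference of the values at \<open>x + t *\<^sub>R h\<close> and
  \<open>x - t *\<^sub>R h\<close> the term \<open>F x\<close> cancels and the linear part is
  \<open>2 * t\<close> times \<open>A h\<close>; the integral of \<open>2 * t\<close> over the unit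
  interval is 1.\<close>

lemma sym_flux_expansion:
  fixes F :: "'a::euclidean_space \<Rightarrow> 'a"
  assumes F: "continuous_on UNIV F" and A: "(F has_derivative A) (at x)" and e: "0 < e"
  obtains \<delta> where "0 < \<delta>" "\<And>h. norm h < \<delta> \<Longrightarrow> \<bar>sym_flux F x h - A h \<bullet> h\<bar> \<le> e * (norm h)\<^sup>2"
proof -
  interpret A: bounded_linear A
    using A by (rule has_derivative_bounded_linear)
  \<comment> \<open>The expansion is applied at two points, hence half of \<open>e\<close> for
    each.\<close>
  obtain \<delta> where \<delta>: "0 < \<delta>"
    "\<And>y. norm (y - x) < \<delta> \<Longrightarrow> norm (F y - F x - A (y - x)) \<le> e / 2 * norm (y - x)"
    using A e unfolding has_derivative_at_alt by (meson half_gt_zero)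
  have "\<bar>sym_flux F x h - A h \<bullet> h\<bar> \<le> e * (norm h)\<^sup>2" if h: "norm h < \<delta>" for h
  proof -
    let ?G = "\<lambda>t. (F (x + t *\<^sub>R h) - F (x - t *\<^sub>R h)) \<bullet> h"
    have "((\<lambda>t. 2 * t * (A h \<bullet> h)) has_integral (1\<^sup>2 * (A h \<bullet> h) - 0\<^sup>2 * (A h \<bullet> h))) {0..1}"
      by (rule fundamental_theorem_of_calculus)
        (auto intro!: derivative_eq_intros simp flip: has_real_derivative_iff_has_vector_derivative)
    then have I: "((\<lambda>t. 2 * t * (A h \<bullet> h)) has_integral (A h \<bullet> h)) {0..1}"
      by simp
    have G: "continuous_on {0..1} ?G"
      by (intro continuous_intros continuous_on_compose2[OF F]) auto
    have "sym_flux F x h - A h \<bullet> h = integral {0..1} (\<lambda>t. ?G t - 2 * t * (A h \<bullet> h))"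
      using I by (subst Henstock_Kurzweil_Integration.integral_diff)
        (auto simp: sym_flux_eq_integral[OF F] integrable_continuous_real[OF G] has_integral_iff)
    moreover have "norm (integral {0..1} (\<lambda>t. ?G t - 2 * t * (A h \<bullet> h))) \<le> e * (norm h)\<^sup>2 * (1 - 0)"
    proof (intro integral_bound)
      show "continuous_on {0..1} (\<lambda>t. ?G t - 2 * t * (A h \<bullet> h))"
        by (intro continuous_intros G)
      show "norm (?G t - 2 * t * (A h \<bullet> h)) \<le> e * (norm h)\<^sup>2" if t: "t \<in> {0..1}" for t
      proof -
        have th: "norm (t *\<^sub>R h) \<le> norm h"
          using t by (simp add: mult_left_le_one_le)
        have le: "e / 2 * norm (t *\<^sub>R h) \<le> e / 2 * norm h"
          using th e by (intro mult_left_mono) auto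
        have "norm (F (x + t *\<^sub>R h) - F x - t *\<^sub>R A h) \<le> e / 2 * norm (t *\<^sub>R h)"
          using \<delta>(2)[of "x + t *\<^sub>R h"] th h by (simp add: A.scaleR)
        note 1 = order_trans[OF this le]
        have "norm (F (x - t *\<^sub>R h) - F x + t *\<^sub>R A h) \<le> e / 2 * norm (t *\<^sub>R h)"
          using \<delta>(2)[of "x - t *\<^sub>R h"] th h by (simp add: A.scaleR A.neg)
        note 2 = order_trans[OF this le]
        have "?G t - 2 * t * (A h \<bullet> h) =
            ((F (x + t *\<^sub>R h) - F x - t *\<^sub>R A h) - (F (x - t *\<^sub>R h) - F x + t *\<^sub>R A h)) \<bullet> h"
          by (simp add: inner_diff_left inner_add_left)
        also have "norm \<dots> \<le> norm ((F (x + t *\<^sub>R h) - F x - t *\<^sub>R A h) - (F (x - t *\<^sub>R h) - F x + t *\<^sub>R A h)) * norm h"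
          using Cauchy_Schwarz_ineq2 by simp
        also have "\<dots> \<le> (e * norm h) * norm h"
          using order_trans[OF norm_triangle_ineq4 add_mono[OF 1 2]] by (intro mult_right_mono) auto
        finally show ?thesis
          by (simp add: power2_eq_square mult.assoc)
      qed
    qed simp
    ultimately show ?thesis
      by simp
  qed
  then show thesis
    using \<delta> that by blast
qed

text \<open>The chain rule along each coordinate line identifies the trace produced by the moment
  computation with the coordinatewise derivatives in \<open>divergence\<close>.\<close>

lemma divergence_eq_trace:
  fixes F :: "real ^ 'n \<Rightarrow> real ^ 'n"
  assumes A: "(F has_derivative A) (at x)"
  shows "divergence F x = (\<Sum>i\<in>UNIV. A (axis i 1) $ i)"
proof -
  have lin: "linear A"
    using A by (rule has_derivative_linear)
  have "((\<lambda>s. F (x + s *\<^sub>R axis i 1) $ i) has_field_derivative A (axis i 1) $ i) (at 0)" for i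
  proof -
    have "((\<lambda>s. x + s *\<^sub>R axis i 1) has_derivative (\<lambda>s. s *\<^sub>R axis i 1)) (at (0 :: real))"
      by (auto intro!: derivative_eq_intros)
    then have "((\<lambda>s. F (x + s *\<^sub>R axis i 1)) has_derivative (\<lambda>s. A (s *\<^sub>R axis i 1))) (at (0 :: real))"
      using has_derivative_compose[of "\<lambda>s. x + s *\<^sub>R axis i 1" _ 0 UNIV F A] A by simp
    then have "((\<lambda>s. F (x + s *\<^sub>R axis i 1) $ i) has_derivative (\<lambda>s. A (s *\<^sub>R axis i 1) $ i)) (at (0 :: real))"
      by (rule bounded_linear.has_derivative[OF bounded_linear_vec_nth])
    then show ?thesis
      unfolding has_field_derivative_def
      by (rule has_derivative_eq_rhs) (simp add: fun_eq_iff linear_scale[OF lin] mult.commute)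
  qed
  then show ?thesis
    unfolding divergence_def by (intro sum.cong refl DERIV_imp_deriv)
qed

section \<open>Radial kernels and their nonlocal divergence\<close>

text \<open>The nonlocal divergence without a principal value: the factor 2 of
  \<open>nonlocal_div\<close> cancels the 1/2 produced by symmetrisation.\<close>

definition kernel_div :: "(real ^ 'n \<Rightarrow> real) \<Rightarrow> (real ^ 'n \<Rightarrow> real ^ 'n) \<Rightarrow> real ^ 'n \<Rightarrow> real" where
  "kernel_div k F x = (LINT h|lebesgue. k h * sym_flux F x h)"

text \<open>The sign condition leaves out the origin, where the kernel inherits the arbitrary value
  of \<open>\<alpha>\<close>; the weight \<open>min 1 ((norm h)\<^sup>2)\<close> vanishes
  there.\<close>

locale levy_kernel =
  fixes k :: "real ^ 'n \<Rightarrow> real"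
  assumes measurable [measurable]: "k \<in> borel_measurable lebesgue"
    and radial: "radial k"
    and nonneg: "h \<noteq> 0 \<Longrightarrow> 0 \<le> k h"
    and integrable_min: "integrable lebesgue (\<lambda>h. k h * min 1 ((norm h)\<^sup>2))"
begin

lemma k_minus: "k (- h) = k h"
  using radial unfolding radial_def by (metis norm_minus_cancel)

lemma
  assumes f: "f \<in> borel_measurable lebesgue" and bound: "\<And>h. \<bar>f h\<bar> \<le> C * min 1 ((norm h)\<^sup>2)"
  shows integrable_bounded: "integrable lebesgue (\<lambda>h. k h * f h)"
    and integral_bounded:
      "\<bar>LINT h|lebesgue. k h * f h\<bar> \<le> C * (LINT h|lebesgue. k h * min 1 ((norm h)\<^sup>2))"
proof -
  have le: "\<bar>k h * f h\<bar> \<le> C * (k h * min 1 ((norm h)\<^sup>2))" for h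
  \<comment> \<open>At the origin the bound forces \<open>f 0 = 0\<close>, so the unknown sign of
    \<open>k 0\<close> does no harm.\<close>
  proof (cases "h = 0")
    case True
    then show ?thesis
      using bound[of 0] by simp
  next
    case False
    then show ?thesis
      using mult_left_mono[OF bound[of h] nonneg[OF False]] nonneg[OF False]
      by (simp add: abs_mult mult_ac)
  qed
  show int: "integrable lebesgue (\<lambda>h. k h * f h)"
    using f unfolding real_norm_def[symmetric]
    by (intro Bochner_Integration.integrable_bound[OF integrable_mult_right[OF integrable_min, of C]]
        AE_I2 borel_measurable_times measurable)
      (simp, unfold real_norm_def, rule order_trans[OF le abs_ge_self])
  have "\<bar>LINT h|lebesgue. k h * f h\<bar> \<le> (LINT h|lebesgue. \<bar>k h * f h\<bar>)"
    by (rule integral_abs_bound)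
  also have "\<dots> \<le> (LINT h|lebesgue. C * (k h * min 1 ((norm h)\<^sup>2)))"
    using int le integrable_min by (intro integral_mono) auto
  finally show "\<bar>LINT h|lebesgue. k h * f h\<bar> \<le> C * (LINT h|lebesgue. k h * min 1 ((norm h)\<^sup>2))"
    by simp
qed

text \<open>Away from the origin the weight is at least \<open>min 1 (\<delta>\<^sup>2)\<close>, so
  a constant bound is a multiple of the weight.\<close>

lemma integrable_tail:
  assumes f: "f \<in> borel_measurable lebesgue" and bound: "\<And>h. \<bar>f h\<bar> \<le> C" and \<delta>: "0 < \<delta>"
  shows "integrable lebesgue (\<lambda>h. k h * (indicator {h. \<delta> < norm h} h * f h))"
proof (rule integrable_bounded)
  show "(\<lambda>h. indicator {h. \<delta> < norm h} h * f h) \<in> borel_measurable lebesgue"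
    using f by measurable
  have C: "0 \<le> C"
    using bound[of 0] by linarith
  show "\<bar>indicator {h. \<delta> < norm h} h * f h\<bar> \<le> C / min 1 (\<delta>\<^sup>2) * min 1 ((norm h)\<^sup>2)" for h
  proof (cases "\<delta> < norm h")
    case True
    then have "\<delta>\<^sup>2 \<le> (norm h)\<^sup>2"
      using \<delta> by (intro power_mono) auto
    then have "min 1 (\<delta>\<^sup>2) \<le> min 1 ((norm h)\<^sup>2)"
      by auto
    then have "C * min 1 (\<delta>\<^sup>2) \<le> C * min 1 ((norm h)\<^sup>2)"
      using C by (intro mult_left_mono)
    moreover have "0 < min 1 (\<delta>\<^sup>2)"
      using \<delta> by simp
    ultimately have "C \<le> C / min 1 (\<delta>\<^sup>2) * min 1 ((norm h)\<^sup>2)"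
      by (simp add: pos_le_divide_eq del: min_less_iff_conj)
    then show ?thesis
      using True bound[of h] by simp
  next
    case False
    then show ?thesis
      using C \<delta> by simp
  qed
qed

end

locale levy_kernel_field = levy_kernel k for k :: "real ^ 'n \<Rightarrow> real" +
  fixes F :: "real ^ 'n \<Rightarrow> real ^ 'n"
  assumes C1: "C1_compactly_supported F"
begin

lemmas continuous_F = C1_compactly_supported_imp_continuous[OF C1]

lemma continuous_line_flux: "continuous_on UNIV (line_flux F x)"
  using continuous_on_compose2[OF continuous_on_line_flux[OF continuous_F], of UNIV "\<lambda>h. (x, h)"]
  by (simp add: continuous_intros)

lemma continuous_sym_flux: "continuous_on UNIV (sym_flux F x)"
  using continuous_on_compose2[OF continuous_on_sym_flux[OF continuous_F], of UNIV "\<lambda>h. (x, h)"]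
  by (simp add: continuous_intros)

lemma continuous_sym_flux_left: "continuous_on UNIV (\<lambda>x. sym_flux F x h)"
  using continuous_on_compose2[OF continuous_on_sym_flux[OF continuous_F], of UNIV "\<lambda>x. (x, h)"]
  by (simp add: continuous_intros)

lemmas measurable_flux [measurable] =
  borel_measurable_lebesgue_continuous[OF continuous_line_flux]
  borel_measurable_lebesgue_continuous[OF continuous_sym_flux]

section \<open>Truncated integrals and the principal value\<close>

text \<open>In the increment \<open>h = y - x\<close> the truncated divergence is the integral of
  \<open>line_flux\<close> against the kernel. Kernel and truncation set are even, so averaging with
  the reflected integral produces \<open>sym_flux\<close> and the factor 1/2.\<close>

lemma truncated_div_eq:
  assumes k: "k = (\<lambda>h. \<alpha> h * \<mu> h)" and \<alpha>: "radial \<alpha>" and \<delta>: "0 < \<delta>"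
  shows "set_integrable lebesgue {y. \<delta> < norm (y - x)} (\<lambda>y. nonlocal_field \<alpha> F x y * \<mu> (y - x))"
    and "truncated_div \<mu> (nonlocal_field \<alpha> F) x \<delta> =
      (LINT h|lebesgue. k h * (indicator {h. \<delta> < norm h} h * sym_flux F x h)) / 2"
proof -
  define g where "g h = k h * (indicator {h. \<delta> < norm h} h * line_flux F x h)" for h
  \<comment> \<open>Before symmetrisation there is no quadratic decay at the origin; integrability
    of \<open>g\<close> comes from the truncation and the boundedness of
    \<open>line_flux\<close>.\<close>
  obtain C where C: "\<And>x h. \<bar>line_flux F x h\<bar> \<le> C"
    using line_flux_bounded[OF continuous_F C1_compactly_supported_imp_bounded_support[OF C1]] by blast
  then have int: "integrable lebesgue g"
    unfolding g_def using \<delta> by (intro integrable_tail) (auto intro: measurable_flux)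
  then have g: "g \<in> borel_measurable lebesgue"
    by (rule borel_measurable_integrable)
  have eq: "indicator {y. \<delta> < norm (y - x)} y *\<^sub>R (nonlocal_field \<alpha> F x y * \<mu> (y - x)) = g (y - x)" for y
  proof (cases "\<delta> < norm (y - x)")
    case True
    have "\<alpha> (x - y) = \<alpha> (y - x)"
      using \<alpha> norm_minus_commute unfolding radial_def by blast
    then show ?thesis
      using True \<delta> by (auto simp: g_def k nonlocal_field_def line_flux_def)
  qed (simp add: g_def)
  show "set_integrable lebesgue {y. \<delta> < norm (y - x)} (\<lambda>y. nonlocal_field \<alpha> F x y * \<mu> (y - x))"
    unfolding set_integrable_def eq integrable_lebesgue_translation[OF g] by (rule int)
  have int': "integrable lebesgue (\<lambda>h. g (- h))"
  proof -
    have "g (- h) = k h * (indicator {h. \<delta> < norm h} h * line_flux F x (- h))" for h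
      by (simp add: g_def indicator_def k_minus)
    moreover have "integrable lebesgue (\<lambda>h. k h * (indicator {h. \<delta> < norm h} h * line_flux F x (- h)))"
      using \<delta> C
      by (intro integrable_tail borel_measurable_lebesgue_continuous
          continuous_on_compose2[OF continuous_line_flux] continuous_intros) auto
    ultimately show ?thesis
      by simp
  qed
  have sum: "g h + g (- h) = k h * (indicator {h. \<delta> < norm h} h * sym_flux F x h)" for h
    by (simp add: g_def indicator_def sym_flux_def k_minus algebra_simps)
  have "truncated_div \<mu> (nonlocal_field \<alpha> F) x \<delta> = (LINT h|lebesgue. g h)"
    unfolding truncated_div_def set_lebesgue_integral_def eq by (rule lebesgue_integral_translation[OF g])
  moreover have "(LINT h|lebesgue. g (- h)) = (LINT h|lebesgue. g h)"
    by (rule lebesgue_integral_reflect[OF g])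
  moreover have "(LINT h|lebesgue. g h + g (- h)) = (LINT h|lebesgue. g h) + (LINT h|lebesgue. g (- h))"
    by (rule Bochner_Integration.integral_add[OF int int'])
  ultimately show "truncated_div \<mu> (nonlocal_field \<alpha> F) x \<delta> =
      (LINT h|lebesgue. k h * (indicator {h. \<delta> < norm h} h * sym_flux F x h)) / 2"
    by (simp add: sum)
qed

lemma truncated_div_tendsto:
  assumes k: "k = (\<lambda>h. \<alpha> h * \<mu> h)" and \<alpha>: "radial \<alpha>"
  shows "(truncated_div \<mu> (nonlocal_field \<alpha> F) x \<longlongrightarrow> kernel_div k F x / 2) (at_right 0)"
proof (rule tendsto_at_right_sequentially[of 0 1])
  fix S :: "nat \<Rightarrow> real"
  assume S: "\<And>n. 0 < S n" "S \<longlonglongrightarrow> 0"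
  obtain C where C: "0 \<le> C" "\<And>x h. \<bar>sym_flux F x h\<bar> \<le> C * min 1 ((norm h)\<^sup>2)"
    using sym_flux_bound[OF C1] by blast
  have "(\<lambda>n. LINT h|lebesgue. k h * (indicator {h. S n < norm h} h * sym_flux F x h)) \<longlonglongrightarrow> kernel_div k F x"
    unfolding kernel_div_def
  proof (rule integral_dominated_convergence)
    show "integrable lebesgue (\<lambda>h. \<bar>k h * sym_flux F x h\<bar>)"
      using C(2) by (intro integrable_abs integrable_bounded measurable_flux)
    show "AE h in lebesgue. norm (k h * (indicator {h. S n < norm h} h * sym_flux F x h)) \<le> \<bar>k h * sym_flux F x h\<bar>" for n
      by (intro AE_I2) (auto simp: abs_mult indicator_def)
    show "AE h in lebesgue. (\<lambda>n. k h * (indicator {h. S n < norm h} h * sym_flux F x h)) \<longlonglongrightarrow> k h * sym_flux F x h"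
    proof (intro AE_I2)
      fix h :: "real ^ 'n"
      show "(\<lambda>n. k h * (indicator {h. S n < norm h} h * sym_flux F x h)) \<longlonglongrightarrow> k h * sym_flux F x h"
      \<comment> \<open>At the origin the bound on \<open>sym_flux\<close> makes the integrand zero;
        elsewhere the truncation is eventually inactive.\<close>
      proof (cases "h = 0")
        case True
        then show ?thesis
          using C(2)[of x 0] by simp
      next
        case False
        then have "\<forall>\<^sub>F n in sequentially. S n < norm h"
          using order_tendstoD(2)[OF S(2)] by simp
        then have "(\<lambda>n. indicat_real {h. S n < norm h} h) \<longlonglongrightarrow> 1"
          by (intro tendsto_eventually) (auto elim!: eventually_mono)
        from tendsto_mult[OF tendsto_const tendsto_mult[OF this tendsto_const]] show ?thesis
          by simp
      qed
    qed
  qed measurable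
  then show "(\<lambda>n. truncated_div \<mu> (nonlocal_field \<alpha> F) x (S n)) \<longlonglongrightarrow> kernel_div k F x / 2"
    unfolding truncated_div_eq(2)[OF k \<alpha> S(1)] by (intro tendsto_intros) auto
qed simp

lemma nonlocal_div_exists:
  assumes "k = (\<lambda>h. \<alpha> h * \<mu> h)" "radial \<alpha>"
  shows "nonlocal_div_exists \<mu> (nonlocal_field \<alpha> F) x"
  using truncated_div_eq(1)[OF assms] truncated_div_tendsto[OF assms]
  unfolding nonlocal_div_exists_def by blast

lemma nonlocal_div_eq:
  assumes "k = (\<lambda>h. \<alpha> h * \<mu> h)" "radial \<alpha>"
  shows "nonlocal_div \<mu> (nonlocal_field \<alpha> F) = kernel_div k F"
proof
  show "nonlocal_div \<mu> (nonlocal_field \<alpha> F) x = kernel_div k F x" for x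
    by (simp add: nonlocal_div_def tendsto_Lim[OF _ truncated_div_tendsto[OF assms]])
qed

section \<open>Continuity, bounds and trace asymptotics of the kernel divergence\<close>

text \<open>The dominating function is independent of the base point. Continuity is what later makes
  the nonlocal divergence measurable on the domain.\<close>

lemma continuous_on_kernel_div: "continuous_on UNIV (kernel_div k F)"
proof (clarsimp simp: continuous_on_sequentially)
  fix X :: "nat \<Rightarrow> real ^ 'n" and x
  assume X: "X \<longlonglongrightarrow> x"
  obtain C where C: "0 \<le> C" "\<And>x h. \<bar>sym_flux F x h\<bar> \<le> C * min 1 ((norm h)\<^sup>2)"
    using sym_flux_bound[OF C1] by blast
  have "(\<lambda>n. kernel_div k F (X n)) \<longlonglongrightarrow> kernel_div k F x"
    unfolding kernel_div_def
  proof (rule integral_dominated_convergence)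
    show "integrable lebesgue (\<lambda>h. C * (k h * min 1 ((norm h)\<^sup>2)))"
      using integrable_min by (rule integrable_mult_right)
    show "AE h in lebesgue. norm (k h * sym_flux F (X n) h) \<le> C * (k h * min 1 ((norm h)\<^sup>2))" for n
    proof (intro AE_I2)
      fix h :: "real ^ 'n"
      show "norm (k h * sym_flux F (X n) h) \<le> C * (k h * min 1 ((norm h)\<^sup>2))"
        using mult_left_mono[OF C(2)[of "X n" h] nonneg[of h]] nonneg[of h] C(2)[of "X n" 0]
        by (cases "h = 0") (auto simp: abs_mult mult_ac)
    qed
    show "AE h in lebesgue. (\<lambda>n. k h * sym_flux F (X n) h) \<longlonglongrightarrow> k h * sym_flux F x h"
      using continuous_on_tendsto_compose[OF continuous_sym_flux_left X]
      by (intro AE_I2 tendsto_intros) auto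
  qed measurable
  then show "((kernel_div k F) \<circ> X) \<longlonglongrightarrow> kernel_div k F x"
    by (simp add: o_def)
qed

text \<open>The bound depends on the kernel only through its mass, hence is the same for a whole
  normalised family.\<close>

lemma kernel_div_bound:
  assumes "\<And>x h. \<bar>sym_flux F x h\<bar> \<le> C * min 1 ((norm h)\<^sup>2)"
  shows "\<bar>kernel_div k F x\<bar> \<le> C * (LINT h|lebesgue. k h * min 1 ((norm h)\<^sup>2))"
  unfolding kernel_div_def using assms by (intro integral_bounded measurable_flux)

text \<open>The linear part of \<open>F\<close> is tested against the finite measure \<open>k h * min 1 ((norm h)\<^sup>2)\<close>
  through the bounded function \<open>(A h \<bullet> h) / (norm h)\<^sup>2\<close>, so that the mass normalisation gives its
  trace exactly, without an error from the tail.\<close>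

lemma kernel_div_near_trace:
  assumes mass: "(LINT h|lebesgue. k h * min 1 ((norm h)\<^sup>2)) = real CARD('n)"
    and A: "linear A" and \<delta>: "0 < \<delta>" "\<delta> \<le> 1"
    and near: "\<And>h. norm h \<le> \<delta> \<Longrightarrow> \<bar>sym_flux F x h - A h \<bullet> h\<bar> \<le> e * (norm h)\<^sup>2" and e: "0 \<le> e"
    and B: "\<And>h. \<bar>A h \<bullet> h\<bar> \<le> B * (norm h)\<^sup>2" and C: "\<And>h. \<bar>sym_flux F x h\<bar> \<le> C * min 1 ((norm h)\<^sup>2)"
  shows "\<bar>kernel_div k F x - (\<Sum>i\<in>UNIV. A (axis i 1) $ i)\<bar> \<le>
    e * real CARD('n) + (B + C) * (LINT h|lebesgue. k h * indicator {h. \<delta> < norm h} h)"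
proof -
  \<comment> \<open>Multiplying by \<open>q\<close> turns \<open>(norm h)\<^sup>2\<close> into the
    mass weight, also at the origin, where division by zero gives \<open>q 0 = 0\<close>. So the
    second moment of \<open>k h * q h\<close> is the mass, which is the dimension.\<close>
  define q where "q h = min 1 ((norm h)\<^sup>2) / (norm h)\<^sup>2" for h :: "real ^ 'n"
  have q_meas [measurable]: "q \<in> borel_measurable lebesgue"
    unfolding q_def by measurable
  have Ah [measurable]: "(\<lambda>h. A h \<bullet> h) \<in> borel_measurable lebesgue"
    using A by (intro borel_measurable_lebesgue_continuous continuous_intros linear_continuous_on)
      (simp add: linear_conv_bounded_linear)
  have q_norm: "q h * (norm h)\<^sup>2 = min 1 ((norm h)\<^sup>2)" for h
    by (simp add: q_def)
  have q: "\<bar>q h * (A h \<bullet> h)\<bar> \<le> B * min 1 ((norm h)\<^sup>2)" for h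
  proof -
    have "\<bar>q h * (A h \<bullet> h)\<bar> \<le> q h * (B * (norm h)\<^sup>2)"
      using B by (simp add: abs_mult q_def mult_left_mono del: times_divide_eq_left)
    also have "\<dots> = B * (q h * (norm h)\<^sup>2)"
      by simp
    finally show ?thesis
      by (simp add: q_norm)
  qed
  have int_q: "integrable lebesgue (\<lambda>h. (k h * q h) * (norm h)\<^sup>2)"
    using integrable_min by (simp add: q_norm mult.assoc)
  have "radial (\<lambda>h. k h * q h)"
    unfolding radial_def
  proof (intro allI impI)
    fix h h' :: "real ^ 'n"
    assume eq: "norm h = norm h'"
    then show "k h * q h = k h' * q h'"
      using radial[unfolded radial_def, rule_format, OF eq] by (simp add: q_def)
  qed
  note mom = radial_quadratic_moment[OF _ this int_q A]
  have km: "(\<lambda>h. k h * q h) \<in> borel_measurable lebesgue"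
    by measurable
  have tr: "(LINT h|lebesgue. k h * (q h * (A h \<bullet> h))) = (\<Sum>i\<in>UNIV. A (axis i 1) $ i)"
    using mom(2)[OF km] by (simp add: mult.assoc q_norm mass)
  let ?f = "\<lambda>h. sym_flux F x h - q h * (A h \<bullet> h)"
  have "kernel_div k F x - (\<Sum>i\<in>UNIV. A (axis i 1) $ i) = (LINT h|lebesgue. k h * ?f h)"
    unfolding kernel_div_def tr[symmetric]
    using integrable_bounded[OF measurable_flux(2) C] mom(1)[OF km]
    by (subst Bochner_Integration.integral_diff[symmetric]) (auto simp: algebra_simps)
  moreover have "\<bar>LINT h|lebesgue. k h * ?f h\<bar> \<le> (LINT h|lebesgue. \<bar>k h * ?f h\<bar>)"
    by (rule integral_abs_bound)
  moreover have "(LINT h|lebesgue. \<bar>k h * ?f h\<bar>) \<le>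
      (LINT h|lebesgue. e * (k h * min 1 ((norm h)\<^sup>2)) + (B + C) * (k h * indicator {h. \<delta> < norm h} h))"
  proof (rule integral_mono)
    have tot: "\<bar>?f h\<bar> \<le> (B + C) * min 1 ((norm h)\<^sup>2)" for h
      using q[of h] C[of h] by (simp add: algebra_simps)
    then show "integrable lebesgue (\<lambda>h. \<bar>k h * ?f h\<bar>)"
      by (intro integrable_abs integrable_bounded) measurable
    show "integrable lebesgue (\<lambda>h. e * (k h * min 1 ((norm h)\<^sup>2)) + (B + C) * (k h * indicator {h. \<delta> < norm h} h))"
      using integrable_tail[of "\<lambda>_. 1" 1 \<delta>] \<delta> integrable_min by auto
    fix h :: "real ^ 'n"
    show "\<bar>k h * ?f h\<bar> \<le> e * (k h * min 1 ((norm h)\<^sup>2)) + (B + C) * (k h * indicator {h. \<delta> < norm h} h)"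
    proof (cases "h = 0")
      case True
      then show ?thesis
        using tot[of 0] \<delta> by simp
    next
      case False
      have "\<bar>?f h\<bar> \<le> e * min 1 ((norm h)\<^sup>2) + (B + C) * indicator {h. \<delta> < norm h} h"
      proof (cases "\<delta> < norm h")
        case True
        \<comment> \<open>No signs of \<open>B\<close> and \<open>C\<close> are assumed; since the
          weight is positive for \<open>h \<noteq> 0\<close>, the bound \<open>tot\<close> forces
          \<open>B + C\<close> to be nonnegative.\<close>
        have "0 \<le> (B + C) * min 1 ((norm h)\<^sup>2)"
          using tot[of h] by linarith
        then have "0 \<le> B + C"
          using False by (simp add: zero_le_mult_iff min_def split: if_splits)
        then have "(B + C) * min 1 ((norm h)\<^sup>2) \<le> (B + C) * 1"
          by (intro mult_left_mono) auto
        moreover have "0 \<le> e * min 1 ((norm h)\<^sup>2)"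
          using e by simp
        ultimately show ?thesis
          using tot[of h] True by simp
      next
        \<comment> \<open>Here \<open>\<delta> \<le> 1\<close> gives \<open>q h = 1\<close>, so
          \<open>?f h\<close> is exactly the remainder controlled by \<open>near\<close>.\<close>
        case small: False
        then have "(norm h)\<^sup>2 \<le> 1"
          using \<delta> power_mono[of "norm h" 1 2] by simp
        then show ?thesis
          using near[of h] small False by (simp add: q_def)
      qed
      note le = mult_left_mono[OF this nonneg[OF False]]
      have "\<bar>k h * ?f h\<bar> = k h * \<bar>?f h\<bar>"
        using nonneg[OF False] by (simp only: abs_mult abs_of_nonneg)
      also note le
      also have "k h * (e * min 1 ((norm h)\<^sup>2) + (B + C) * indicator {h. \<delta> < norm h} h) =
          e * (k h * min 1 ((norm h)\<^sup>2)) + (B + C) * (k h * indicator {h. \<delta> < norm h} h)"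
        by (simp add: algebra_simps)
      finally show ?thesis .
    qed
  qed
  moreover have "\<dots> = e * real CARD('n) + (B + C) * (LINT h|lebesgue. k h * indicator {h. \<delta> < norm h} h)"
    using integrable_tail[of "\<lambda>_. 1" 1 \<delta>] \<delta> integrable_min by (simp add: mass)
  ultimately show ?thesis
    by linarith
qed

end

section \<open>Concentration of the kernels\<close>

text \<open>The error splits into a Taylor remainder, weighted by the fixed mass, and a tail outside
  a small ball. The radius is chosen first, from the remainder alone, and then the tail tends to
  0.\<close>

lemma kernel_div_tendsto_divergence:
  fixes k :: "nat \<Rightarrow> real ^ 'n \<Rightarrow> real"
  assumes K: "\<And>n. levy_kernel_field (k n) F"
    and mass: "\<And>n. (LINT h|lebesgue. k n h * min 1 ((norm h)\<^sup>2)) = real CARD('n)"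
    and tail: "\<And>\<delta>. 0 < \<delta> \<Longrightarrow> (\<lambda>n. LINT h|lebesgue. k n h * indicator {h. \<delta> < norm h} h) \<longlonglongrightarrow> 0"
  shows "(\<lambda>n. kernel_div (k n) F x) \<longlonglongrightarrow> divergence F x"
proof -
  \<comment> \<open>Any index would do: only facts about \<open>F\<close> are taken from this
    instance.\<close>
  interpret levy_kernel_field "k 0" F
    by (rule K)
  obtain A where A: "(F has_derivative A) (at x)"
    using C1 unfolding C1_compactly_supported_def by blast
  have lin: "linear A" and blin: "bounded_linear A"
    using A by (auto intro: has_derivative_linear has_derivative_bounded_linear)
  obtain C where C: "\<And>x h. \<bar>sym_flux F x h\<bar> \<le> C * min 1 ((norm h)\<^sup>2)"
    using sym_flux_bound[OF C1] by blast
  define B where "B = onorm A"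
  have B: "\<bar>A h \<bullet> h\<bar> \<le> B * (norm h)\<^sup>2" for h
  proof -
    have "\<bar>A h \<bullet> h\<bar> \<le> norm (A h) * norm h"
      by (rule Cauchy_Schwarz_ineq2)
    also have "\<dots> \<le> (B * norm h) * norm h"
      unfolding B_def by (intro mult_right_mono onorm[OF blin]) auto
    finally show ?thesis
      by (simp add: power2_eq_square mult.assoc)
  qed
  show ?thesis
  proof (rule tendstoI)
    fix e :: real
    assume e: "0 < e"
    define e' where "e' = e / (2 * real CARD('n))"
    have e': "0 < e'" "e' * real CARD('n) = e / 2"
      using e by (auto simp: e'_def)
    obtain \<delta> where \<delta>: "0 < \<delta>" "\<And>h. norm h < \<delta> \<Longrightarrow> \<bar>sym_flux F x h - A h \<bullet> h\<bar> \<le> e' * (norm h)\<^sup>2"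
      using sym_flux_expansion[OF continuous_F A e'(1)] by blast
    \<comment> \<open>Strictly below \<open>\<delta>\<close>, because a closed ball has to fit into
      the open one, and at most 1, so that the weight is quadratic inside it.\<close>
    define \<eta> where "\<eta> = min (\<delta> / 2) 1"
    have \<eta>: "0 < \<eta>" "\<eta> \<le> 1" "\<eta> < \<delta>"
      using \<delta>(1) by (auto simp: \<eta>_def)
    have "(\<lambda>n. (B + C) * (LINT h|lebesgue. k n h * indicator {h. \<eta> < norm h} h)) \<longlonglongrightarrow> 0"
      by (intro tendsto_mult_right_zero tail \<eta>)
    then have "\<forall>\<^sub>F n in sequentially. (B + C) * (LINT h|lebesgue. k n h * indicator {h. \<eta> < norm h} h) < e / 2"
      by (rule order_tendstoD) (use e in simp)
    then show "\<forall>\<^sub>F n in sequentially. dist (kernel_div (k n) F x) (divergence F x) < e"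
    proof (rule eventually_mono)
      fix n
      assume n: "(B + C) * (LINT h|lebesgue. k n h * indicator {h. \<eta> < norm h} h) < e / 2"
      have "\<bar>kernel_div (k n) F x - (\<Sum>i\<in>UNIV. A (axis i 1) $ i)\<bar> \<le> e' * real CARD('n) +
          (B + C) * (LINT h|lebesgue. k n h * indicator {h. \<eta> < norm h} h)"
        using \<delta>(2) \<eta> e'(1)
        by (intro levy_kernel_field.kernel_div_near_trace K mass lin B C) auto
      then show "dist (kernel_div (k n) F x) (divergence F x) < e"
        using n by (simp add: divergence_eq_trace[OF A] dist_real_def e'(2))
    qed
  qed
qed

section \<open>From extended nonnegative integrals to real integrals\<close>

text \<open>A finite extended integral yields integrability of the weighted kernel and not just a
  value; the weight makes it nonnegative at the origin as well.\<close>

lemma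
  fixes k :: "real ^ 'n \<Rightarrow> real"
  assumes k: "k \<in> borel_measurable lebesgue" "radial k" "\<And>h. h \<noteq> 0 \<Longrightarrow> 0 \<le> k h"
    and mass: "(\<integral>\<^sup>+ h. ennreal (min 1 ((norm h)\<^sup>2) * k h) \<partial>lebesgue) = ennreal c" and c: "0 \<le> c"
  shows levy_kernelI: "levy_kernel k"
    and levy_kernel_mass: "(LINT h|lebesgue. k h * min 1 ((norm h)\<^sup>2)) = c"
proof -
  note [measurable] = k(1)
  have nn: "0 \<le> k h * min 1 ((norm h)\<^sup>2)" for h
    using k(3)[of h] by (cases "h = 0") auto
  have mass': "(\<integral>\<^sup>+ h. ennreal (k h * min 1 ((norm h)\<^sup>2)) \<partial>lebesgue) = ennreal c"
    using mass by (simp add: mult.commute)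
  have "integrable lebesgue (\<lambda>h. k h * min 1 ((norm h)\<^sup>2))"
    by (rule integrableI_nn_integral_finite[OF _ _ mass']) (use nn in \<open>auto\<close>)
  then show "levy_kernel k"
    using k by unfold_locales
  have "(LINT h|lebesgue. k h * min 1 ((norm h)\<^sup>2)) = enn2real (ennreal c)"
    unfolding mass'[symmetric] by (rule integral_eq_nn_integral) (use nn in \<open>auto\<close>)
  then show "(LINT h|lebesgue. k h * min 1 ((norm h)\<^sup>2)) = c"
    using c by simp
qed

lemma levy_kernel_tail:
  fixes k :: "real ^ 'n \<Rightarrow> real"
  assumes k [measurable]: "k \<in> borel_measurable lebesgue"
    and nonneg: "\<And>h. h \<noteq> 0 \<Longrightarrow> 0 \<le> k h" and \<delta>: "0 < \<delta>"
  shows "(LINT h|lebesgue. k h * indicator {h. \<delta> < norm h} h) =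
      enn2real (\<integral>\<^sup>+ h\<in>{h. \<delta> < norm h}. ennreal (k h) \<partial>lebesgue)"
proof -
  have "(LINT h|lebesgue. k h * indicator {h. \<delta> < norm h} h) =
      enn2real (\<integral>\<^sup>+ h. ennreal (k h * indicator {h. \<delta> < norm h} h) \<partial>lebesgue)"
  proof (rule integral_eq_nn_integral)
    show "AE h in lebesgue. 0 \<le> k h * indicator {h. \<delta> < norm h} h"
      using \<delta> by (intro AE_I2) (auto simp: indicator_def intro!: nonneg)
  qed measurable
  also have "(\<integral>\<^sup>+ h. ennreal (k h * indicator {h. \<delta> < norm h} h) \<partial>lebesgue) =
      (\<integral>\<^sup>+ h\<in>{h. \<delta> < norm h}. ennreal (k h) \<partial>lebesgue)"
    by (intro nn_integral_cong) (auto simp: indicator_def)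
  finally show ?thesis .
qed

theorem proposition3p1:
  fixes \<Omega> :: "(real ^ 'n) set"
    and \<alpha> \<mu> :: "real \<Rightarrow> real ^ 'n \<Rightarrow> real"
    and F :: "real ^ 'n \<Rightarrow> real ^ 'n"
  assumes "open \<Omega>" and "bounded \<Omega>"
    and "\<And>\<epsilon>. \<epsilon> \<in> {0<..<1} \<Longrightarrow> \<alpha> \<epsilon> \<in> borel_measurable lebesgue"
    and "\<And>\<epsilon>. \<epsilon> \<in> {0<..<1} \<Longrightarrow> radial (\<alpha> \<epsilon>)"
    and "\<And>\<epsilon> h. \<epsilon> \<in> {0<..<1} \<Longrightarrow> h \<noteq> 0 \<Longrightarrow> 0 \<le> \<alpha> \<epsilon> h"
    and "\<And>\<epsilon>. \<epsilon> \<in> {0<..<1} \<Longrightarrow> \<mu> \<epsilon> \<in> borel_measurable lebesgue"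
    and "\<And>\<epsilon>. \<epsilon> \<in> {0<..<1} \<Longrightarrow> radial (\<mu> \<epsilon>)"
    and "\<And>\<epsilon> h. \<epsilon> \<in> {0<..<1} \<Longrightarrow> 0 \<le> \<mu> \<epsilon> h"
    and "\<And>\<epsilon>. \<epsilon> \<in> {0<..<1} \<Longrightarrow>
           (\<integral>\<^sup>+ h. ennreal (min 1 ((norm h)\<^sup>2) * \<alpha> \<epsilon> h * \<mu> \<epsilon> h) \<partial>lebesgue) = of_nat CARD('n)"
    and "\<And>\<delta>. 0 < \<delta> \<Longrightarrow>
           ((\<lambda>\<epsilon>. \<integral>\<^sup>+ h\<in>{h. \<delta> < norm h}. ennreal (\<alpha> \<epsilon> h * \<mu> \<epsilon> h) \<partial>lebesgue) \<longlongrightarrow> 0) (at_right 0)"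
    and "C1_compactly_supported F"
  shows "(\<forall>\<epsilon>\<in>{0<..<1}.
            (\<forall>x\<in>\<Omega>. nonlocal_div_exists (\<mu> \<epsilon>) (nonlocal_field (\<alpha> \<epsilon>) F) x) \<and>
            set_integrable lebesgue \<Omega> (nonlocal_div (\<mu> \<epsilon>) (nonlocal_field (\<alpha> \<epsilon>) F))) \<and>
         ((\<lambda>\<epsilon>. LINT x:\<Omega>|lebesgue. nonlocal_div (\<mu> \<epsilon>) (nonlocal_field (\<alpha> \<epsilon>) F) x)
            \<longlongrightarrow> (LINT x:\<Omega>|lebesgue. divergence F x)) (at_right 0)"
proof -
  define k where "k \<epsilon> h = \<alpha> \<epsilon> h * \<mu> \<epsilon> h" for \<epsilon> h
  have k: "k \<epsilon> = (\<lambda>h. \<alpha> \<epsilon> h * \<mu> \<epsilon> h)" for \<epsilon>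
    by (simp add: k_def fun_eq_iff)
  have k_meas: "k \<epsilon> \<in> borel_measurable lebesgue" if "\<epsilon> \<in> {0<..<1}" for \<epsilon>
    unfolding k using assms(3,6)[OF that] by measurable
  have k_radial: "radial (k \<epsilon>)" if "\<epsilon> \<in> {0<..<1}" for \<epsilon>
    using assms(4,7)[OF that] unfolding radial_def k_def by metis
  have k_nonneg: "0 \<le> k \<epsilon> h" if "\<epsilon> \<in> {0<..<1}" "h \<noteq> 0" for \<epsilon> h
    using assms(5,8) that by (simp add: k_def)
  have k_mass: "(\<integral>\<^sup>+ h. ennreal (min 1 ((norm h)\<^sup>2) * k \<epsilon> h) \<partial>lebesgue) = ennreal (real CARD('n))"
    if "\<epsilon> \<in> {0<..<1}" for \<epsilon>
    using assms(9)[OF that] by (simp add: k_def mult.assoc ennreal_of_nat_eq_real_of_nat)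
  note kernel_rules = k_meas k_radial k_nonneg k_mass
  have K: "levy_kernel_field (k \<epsilon>) F" if "\<epsilon> \<in> {0<..<1}" for \<epsilon>
    using levy_kernelI[OF kernel_rules] that assms(11)
    by (simp add: levy_kernel_field_def levy_kernel_field_axioms_def)
  have mass: "(LINT h|lebesgue. k \<epsilon> h * min 1 ((norm h)\<^sup>2)) = real CARD('n)" if "\<epsilon> \<in> {0<..<1}" for \<epsilon>
    using levy_kernel_mass[OF kernel_rules] that by simp
  have nonlocal: "nonlocal_div (\<mu> \<epsilon>) (nonlocal_field (\<alpha> \<epsilon>) F) = kernel_div (k \<epsilon>) F" if "\<epsilon> \<in> {0<..<1}" for \<epsilon>
    by (rule levy_kernel_field.nonlocal_div_eq[OF K[OF that] k assms(4)[OF that]])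
  \<comment> \<open>\<open>C\<close> depends on \<open>F\<close> alone, so the bound below is
    uniform in both the point and the parameter.\<close>
  obtain C where C: "0 \<le> C" "\<And>x h. \<bar>sym_flux F x h\<bar> \<le> C * min 1 ((norm h)\<^sup>2)"
    using sym_flux_bound[OF assms(11)] by blast
  have bound: "\<bar>kernel_div (k \<epsilon>) F x\<bar> \<le> C * real CARD('n)" if "\<epsilon> \<in> {0<..<1}" for \<epsilon> x
    using levy_kernel_field.kernel_div_bound[OF K[OF that] C(2), of x] by (simp only: mass[OF that])
  have \<Omega>: "\<Omega> \<in> lmeasurable"
    using assms(1,2) by (rule lmeasurable_open[rotated])
  then have \<Omega>_sets [measurable]: "\<Omega> \<in> sets lebesgue"
    by (rule fmeasurableD)
  \<comment> \<open>The constant bound is integrable because the bounded set \<open>\<Omega>\<close>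
    has finite measure.\<close>
  have dom: "integrable lebesgue (\<lambda>x. indicat_real \<Omega> x * (C * real CARD('n)))"
    using \<Omega> by (intro integrable_mult_left) (simp add: fmeasurable_def integrable_indicator_iff)
  have meas: "(\<lambda>x. indicat_real \<Omega> x * kernel_div (k \<epsilon>) F x) \<in> borel_measurable lebesgue" if "\<epsilon> \<in> {0<..<1}" for \<epsilon>
    using borel_measurable_lebesgue_continuous[OF levy_kernel_field.continuous_on_kernel_div[OF K[OF that]]]
    by measurable
  have le: "norm (indicat_real \<Omega> x * kernel_div (k \<epsilon>) F x) \<le> indicat_real \<Omega> x * (C * real CARD('n))"
    if "\<epsilon> \<in> {0<..<1}" for \<epsilon> x
    using bound[OF that, of x] by (simp add: indicator_def)
  have int: "integrable lebesgue (\<lambda>x. indicat_real \<Omega> x * kernel_div (k \<epsilon>) F x)" if "\<epsilon> \<in> {0<..<1}" for \<epsilon>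
    using le[OF that] by (intro Bochner_Integration.integrable_bound[OF dom meas[OF that]] AE_I2)
      (auto intro: order_trans[OF _ abs_ge_self])
  have lim: "((\<lambda>\<epsilon>. LINT x:\<Omega>|lebesgue. nonlocal_div (\<mu> \<epsilon>) (nonlocal_field (\<alpha> \<epsilon>) F) x)
      \<longlongrightarrow> (LINT x:\<Omega>|lebesgue. divergence F x)) (at_right 0)"
  \<comment> \<open>Dominated convergence is sequential; the endpoint 1 keeps the sequences in the
    range where the hypotheses on the kernels hold.\<close>
  proof (rule tendsto_at_right_sequentially[of 0 1])
    fix S :: "nat \<Rightarrow> real"
    assume S: "\<And>n. 0 < S n" "\<And>n. S n < 1" "S \<longlonglongrightarrow> 0"
    then have S01: "S n \<in> {0<..<1}" for n
      by simp
    have S0: "filterlim S (at_right 0) sequentially"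
      using S(3) S(1)[THEN less_imp_neq, symmetric] S(1) by (simp add: filterlim_at)
    have tail: "(\<lambda>n. LINT h|lebesgue. k (S n) h * indicator {h. \<delta> < norm h} h) \<longlonglongrightarrow> 0" if \<delta>: "0 < \<delta>" for \<delta>
    proof -
      have "(\<lambda>n. enn2real (\<integral>\<^sup>+ h\<in>{h. \<delta> < norm h}. ennreal (k (S n) h) \<partial>lebesgue)) \<longlonglongrightarrow> 0"
        using filterlim_compose[OF assms(10)[OF \<delta>] S0] by (intro tendsto_enn2real) (auto simp: k_def)
      then show ?thesis
        using levy_kernel_tail[OF k_meas[OF S01] k_nonneg[OF S01] \<delta>] by simp
    qed
    have pointwise: "(\<lambda>n. kernel_div (k (S n)) F x) \<longlonglongrightarrow> divergence F x" for x
      by (rule kernel_div_tendsto_divergence[OF K[OF S01] mass[OF S01] tail])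
    have limx: "(\<lambda>n. indicat_real \<Omega> x * kernel_div (k (S n)) F x) \<longlonglongrightarrow> indicat_real \<Omega> x * divergence F x" for x
      by (intro tendsto_intros pointwise)
    have "(\<lambda>n. LINT x|lebesgue. indicat_real \<Omega> x * kernel_div (k (S n)) F x) \<longlonglongrightarrow>
        (LINT x|lebesgue. indicat_real \<Omega> x * divergence F x)"
    proof (rule integral_dominated_convergence[OF _ _ dom])
      \<comment> \<open>Measurability of the limit is inherited from the approximating functions
        through pointwise convergence.\<close>
      show "(\<lambda>x. indicat_real \<Omega> x * divergence F x) \<in> borel_measurable lebesgue"
        by (rule borel_measurable_LIMSEQ_real[OF limx meas[OF S01]])
    qed (use limx meas[OF S01] le[OF S01] in auto)
    then show "(\<lambda>n. LINT x:\<Omega>|lebesgue. nonlocal_div (\<mu> (S n)) (nonlocal_field (\<alpha> (S n)) F) x) \<longlonglongrightarrow>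
        (LINT x:\<Omega>|lebesgue. divergence F x)"
      by (simp add: set_lebesgue_integral_def nonlocal[OF S01])
  qed simp
  show ?thesis
  proof (intro conjI ballI lim)
    fix \<epsilon> :: real
    assume \<epsilon>: "\<epsilon> \<in> {0<..<1}"
    show "nonlocal_div_exists (\<mu> \<epsilon>) (nonlocal_field (\<alpha> \<epsilon>) F) x" for x
      by (rule levy_kernel_field.nonlocal_div_exists[OF K[OF \<epsilon>] k assms(4)[OF \<epsilon>]])
    show "set_integrable lebesgue \<Omega> (nonlocal_div (\<mu> \<epsilon>) (nonlocal_field (\<alpha> \<epsilon>) F))"
      using int[OF \<epsilon>] by (simp add: set_integrable_def nonlocal[OF \<epsilon>])
  qed
qed

end
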